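(* Let $\mathbb{X}$ be a finite dimensional smooth real Banach space and let $T \in \mathbb{L}(\mathbb{X})$ be a nonzero bounded linear operator such that $\ker T$ contains a nonzero right symmetric point. Then $\operatorname{span} M_T$ is a proper subspace of $\mathbb{X}$. In particular, if $T \in \mathbb{L}(l_p^n)$ is such that for some $i \in \{1, 2, \ldots, n\}$, $T(e_i) = 0$, where $e_i$ denotes the unit vector whose $i$-th component is $1$ and all other components are $0$, then \[ \min\{\|Tx_j\| : j \in \{1, 2, \ldots, n\}\} < \|T\| \] for any basis $\{x_1, x_2, \ldots, x_n\}$ of $l_p^n$.
   Context: $\mathbb{L}(\mathbb{X})$ is the space of bounded linear operators on $\mathbb{X}$. $S_{\mathbb{X}} = \{x \in \mathbb{X} : \|x\| = 1\}$ and $M_T = \{x \in S_{\mathbb{X}} : \|Tx\| = \|T\|\}$. For $x,y \in \mathbb{X}$, $x \perp_B y$ (Birkhoff-James orthogonality) means $\|x\| \le \|x + \lambda y\|$ for all $\lambda \in \mathbb{R}$. A point $x \in \mathbb{X}$ is right symmetric if for every $y \in \mathbb{X}$, $y \perp_B x$ implies $x \perp_B y$. A Banach space is smooth if each point $x$ of its unit sphere has a unique norm-one functional $f$ with $f(x) = 1$. $l_p^n$ is $\mathbb{R}^n$ with the $p$-norm.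
   Formalization: In the second claim, T is taken nonzero, 1 ≤ p < ∞, and the basis vectors x_j have p-norm 1; otherwise it fails: T = 0; for p = 2, T(x1,x2) = (0,x2) with basis (0,2),(1,2); for p = ∞, the same T with basis (1,1),(-1,1). *)

theory Defs
  imports "HOL-Analysis.Analysis"
begin

definition birkhoff_james_orthogonal :: "'a::real_normed_vector \<Rightarrow> 'a \<Rightarrow> bool"
    (infix "\<bottom>\<^sub>B" 50) where
  "x \<bottom>\<^sub>B y \<longleftrightarrow> (\<forall>c::real. norm x \<le> norm (x + c *\<^sub>R y))"

definition right_symmetric :: "'a::real_normed_vector \<Rightarrow> bool" where
  "right_symmetric x \<longleftrightarrow> (\<forall>y. y \<bottom>\<^sub>B x \<longrightarrow> x \<bottom>\<^sub>B y)"

definition norm_attainment_set ::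
    "('a::real_normed_vector \<Rightarrow>\<^sub>L 'b::real_normed_vector) \<Rightarrow> 'a set" where
  "norm_attainment_set T = {x. norm x = 1 \<and> norm (blinfun_apply T x) = norm T}"

definition smooth_space :: "'a::real_normed_vector itself \<Rightarrow> bool" where
  "smooth_space _ \<longleftrightarrow>
    (\<forall>x::'a. norm x = 1 \<longrightarrow> (\<exists>!f::'a \<Rightarrow>\<^sub>L real. norm f = 1 \<and> blinfun_apply f x = 1))"

(* The space of n-tuples with the p-norm, for a real exponent p \<ge> 1, is the vector space
   real ^ 'n with n = CARD('n), considered with lp_norm p in place of the Euclidean norm of
   the class instance.  The operator norm with respect to lp_norm p is written like onorm;
   the term for x = 0 is 0. *)

definition lp_norm :: "real \<Rightarrow> real ^ 'n \<Rightarrow> real" where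
  "lp_norm p x = (\<Sum>k\<in>UNIV. \<bar>x $ k\<bar> powr p) powr (1 / p)"

definition lp_onorm :: "real \<Rightarrow> (real ^ 'n \<Rightarrow> real ^ 'm) \<Rightarrow> real" where
  "lp_onorm p S = (SUP x. lp_norm p (S x) / lp_norm p x)"

end

theory Submission
  imports Defs
begin

text \<open>
  Both halves rest on one remark: a nonzero operator cannot attain its norm at a unit vector \<open>x\<close> whose
  norm can be decreased by adding a vector of the kernel. So if \<open>T \<noteq> 0\<close> and \<open>T z = 0\<close>, then
  \<open>x \<bottom>\<^sub>B z\<close> for every \<open>x\<close> in the norm attainment set
  (\<open>norm_attainment_orthogonal_kernel\<close>).

  When \<open>z\<close> is right symmetric, this turns into \<open>z \<bottom>\<^sub>B x\<close>, and now the vectors \<open>x\<close> stand on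
  the side on which Birkhoff-James orthogonality is additive in a smooth space. Indeed, by a
  Hahn-Banach extension \<open>z \<bottom>\<^sub>B x\<close> provides a norm-one functional that supports the unit ball at
  \<open>z / norm z\<close> and vanishes at \<open>x\<close>. Smoothness allows only one supporting functional there, so a
  single functional \<open>f\<close> with \<open>f z \<noteq> 0\<close> vanishes on the whole norm attainment set
  (\<open>smooth_birkhoff_james_hyperplane\<close>), and the span lies in its kernel. As the
  space has a finite spanning set, Hahn-Banach follows by induction from the extension by one
  vector.

  The \<open>p\<close>-norm is treated without functionals, since \<open>p = 1\<close> is included and the space is then
  in general not smooth. The role of \<open>f\<close> is played by the \<open>i\<close>-th coordinate: deleting a
  nonzero \<open>i\<close>-th coordinate from \<open>x\<close> keeps \<open>S x\<close> and strictly decreases the norm. Hence every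
  vector at which \<open>S\<close> attains its norm has \<open>i\<close>-th coordinate zero
  (\<open>lp_norm_attained_imp_component_0\<close>), and such vectors cannot form a basis.
\<close>

section \<open>Supporting functionals in finite dimension\<close>

text \<open>
  The inductive step of the Hahn-Banach theorem. Functionals on a subspace are
  represented by linear functions on the whole space, of which only the values on that subspace
  matter; extending means correcting \<open>f\<close> by a multiple of a functional \<open>h\<close> that vanishes on \<open>V\<close>
  and not at \<open>v\<close>. The triangle inequality makes the lower bounds for the new value at \<open>v\<close> stay
  below the upper bounds, so there is room for it.
\<close>

lemma dominated_functional_extend_one:
  fixes f :: "'a::real_normed_vector \<Rightarrow> real"
  assumes f: "linear f" and V: "subspace V" and dom: "\<And>x. x \<in> V \<Longrightarrow> f x \<le> norm x"
  shows "\<exists>g. linear g \<and> (\<forall>x\<in>V. g x = f x) \<and> (\<forall>x\<in>span (insert v V). g x \<le> norm x)"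
proof (cases "v \<in> V")
  case True
  then have "span (insert v V) = V"
    using V by (simp add: insert_absorb span_eq_iff)
  with f dom show ?thesis by auto
next
  case False
  obtain B where B: "B \<subseteq> V" "independent B" "V \<subseteq> span B"
    using basis_exists[of V] by metis
  have "span B \<subseteq> V"
    using B(1) V span_minimal by blast
  then have "independent (insert v B)"
    using False B(2) by (auto simp: independent_insert)
  then obtain h :: "'a \<Rightarrow> real"
    where h: "linear h" and hB: "\<forall>x\<in>insert v B. h x = (if x = v then 1 else 0)"
    using linear_independent_extend[of "insert v B" "\<lambda>x. if x = v then 1 else 0"] by auto
  have hv: "h v = 1" using hB by simp
  have "\<And>b. b \<in> B \<Longrightarrow> h b = 0"
    using hB B(1) False by auto
  then have hV: "h x = 0" if "x \<in> V" for x
    using linear_eq_0_on_span[OF h] B(3) that by blast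
  have cross: "f u - norm (u - v) \<le> norm (w + v) - f w" if "u \<in> V" "w \<in> V" for u w
  proof -
    have "f u + f w = f (u + w)" by (simp add: linear_add[OF f])
    also have "\<dots> \<le> norm (u + w)" using dom V that by (simp add: subspace_add)
    also have "\<dots> \<le> norm (u - v) + norm (w + v)"
      using norm_triangle_ineq[of "u - v" "w + v"] by simp
    finally show ?thesis by simp
  qed
  \<comment> \<open>The value at \<open>v\<close>: any number between the two sides of \<open>cross\<close> would do.\<close>
  define a where "a = (SUP u\<in>V. f u - norm (u - v))"
  have "0 \<in> V" using V by (simp add: subspace_0)
  have lower: "f u - norm (u - v) \<le> a" if "u \<in> V" for u
    unfolding a_def
  proof (rule cSUP_upper[OF that])
    show "bdd_above ((\<lambda>u. f u - norm (u - v)) ` V)"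
      using cross[OF _ \<open>0 \<in> V\<close>] by (intro bdd_aboveI2)
  qed
  have upper: "a \<le> norm (w + v) - f w" if "w \<in> V" for w
    unfolding a_def using \<open>0 \<in> V\<close> cross that by (intro cSUP_least) auto
  define g where "g = (\<lambda>x. f x + (a - f v) * h x)"
  have g: "linear g"
    unfolding g_def using linear_compose_add[OF f linear_compose_scale_right[OF h, of "a - f v"]]
    by simp
  have gV: "g x = f x" if "x \<in> V" for x
    using that by (simp add: g_def hV)
  have gv: "g v = a" by (simp add: g_def hv)
  have "g x \<le> norm x" if "x \<in> span (insert v V)" for x
  proof -
    obtain c where "x - c *\<^sub>R v \<in> V"
      using \<open>x \<in> span (insert v V)\<close> unfolding span_breakdown_eq span_eq_iff[THEN iffD2, OF V] by blast
    then obtain u where u: "u \<in> V" and x: "x = u + c *\<^sub>R v"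
      by (metis diff_add_cancel)
    have gx: "g x = f u + c * a"
      using u by (simp add: x linear_add[OF g] linear_scale[OF g] gV gv)
    consider "c = 0" | "c > 0" | "c < 0" by linarith
    then show ?thesis
    proof cases
      case 1
      then show ?thesis using gx x u dom by simp
    next
      case 2
      have "f u + c * a = c * (f ((1/c) *\<^sub>R u) + a)"
        using 2 by (simp add: linear_scale[OF f] field_simps)
      also have "\<dots> \<le> c * norm ((1/c) *\<^sub>R u + v)"
        using 2 upper[of "(1/c) *\<^sub>R u"] u V by (intro mult_left_mono) (auto simp: subspace_scale)
      also have "\<dots> = norm (c *\<^sub>R ((1/c) *\<^sub>R u + v))" using 2 by simp
      also have "\<dots> = norm x" using 2 by (simp add: x scaleR_add_right)
      finally show ?thesis using gx by simp
    next
      case 3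
      have "f u + c * a = (-c) * (f ((-1/c) *\<^sub>R u) - a)"
        using 3 by (simp add: linear_scale[OF f] linear_neg[OF f] field_simps)
      also have "\<dots> \<le> (-c) * norm ((-1/c) *\<^sub>R u - v)"
        using 3 lower[of "(-1/c) *\<^sub>R u"] u V subspace_scale[OF V u, of "-1/c"] by (intro mult_left_mono) auto
      also have "\<dots> = norm ((-c) *\<^sub>R ((-1/c) *\<^sub>R u - v))" using 3 by simp
      also have "(-c) *\<^sub>R ((-1/c) *\<^sub>R u - v) = x" using 3 by (simp add: x scaleR_diff_right)
      finally show ?thesis using gx by simp
    qed
  qed
  with g gV show ?thesis by blast
qed

lemma dominated_functional_extend:
  fixes f :: "'a::real_normed_vector \<Rightarrow> real"
  assumes f: "linear f" and V: "subspace V" and dom: "\<And>x. x \<in> V \<Longrightarrow> f x \<le> norm x"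
    and "finite B"
  shows "\<exists>g. linear g \<and> (\<forall>x\<in>V. g x = f x) \<and> (\<forall>x\<in>span (B \<union> V). g x \<le> norm x)"
  using \<open>finite B\<close>
proof (induction B)
  case empty
  then show ?case using f dom span_eq_iff[THEN iffD2, OF V] by (intro exI[of _ f]) (simp del: span_eq_iff)
next
  case (insert b B)
  then obtain g where g: "linear g" "\<forall>x\<in>V. g x = f x" "\<forall>x\<in>span (B \<union> V). g x \<le> norm x"
    by blast
  obtain k where k: "linear k" "\<forall>x\<in>span (B \<union> V). k x = g x"
      "\<forall>x\<in>span (insert b (span (B \<union> V))). k x \<le> norm x"
    using dominated_functional_extend_one[OF g(1) subspace_span, of "B \<union> V" b] g(3) by blast
  have "span (insert b B \<union> V) \<subseteq> span (insert b (span (B \<union> V)))"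
    by (intro span_mono) (auto intro: span_base)
  moreover have "V \<subseteq> span (B \<union> V)" by (auto intro: span_base)
  ultimately show ?case using k g(2) by (intro exI[of _ k]) auto
qed

text \<open>
  James' description of orthogonality: \<open>x \<bottom>\<^sub>B y\<close> says precisely that the functional
  \<open>a x + b y \<mapsto> a\<close> on the plane of \<open>x\<close> and \<open>y\<close> is dominated by the norm, so that it extends
  to the whole space with norm one.
\<close>

lemma birkhoff_james_supporting_functional:
  fixes x y :: "'a::real_normed_vector"
  assumes fin: "finite B" "span B = (UNIV :: 'a set)" and "norm x = 1" and orth: "x \<bottom>\<^sub>B y"
  shows "\<exists>g :: 'a \<Rightarrow>\<^sub>L real. norm g = 1 \<and> blinfun_apply g x = 1 \<and> blinfun_apply g y = 0"
proof -
  have xspan: "x \<notin> span {y}"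
  proof
    assume "x \<in> span {y}"
    then obtain c where "x = c *\<^sub>R y" by (auto simp: span_singleton)
    then have "norm x \<le> 0" using orth unfolding birkhoff_james_orthogonal_def
      by (metis add.right_inverse norm_zero scaleR_minus_left)
    with \<open>norm x = 1\<close> show False by simp
  qed
  have "\<exists>f :: 'a \<Rightarrow> real. linear f \<and> f x = 1 \<and> f y = 0"
  proof (cases "y = 0")
    case True
    have "independent {x}" using \<open>norm x = 1\<close> by auto
    then obtain f :: "'a \<Rightarrow> real" where "linear f" "f x = 1"
      using linear_independent_extend[of "{x}" "\<lambda>_. 1"] by auto
    with True show ?thesis using linear_0 by blast
  next
    case False
    then have ind: "independent {x, y}" and "x \<noteq> y"
      using xspan by (auto simp: independent_insert span_base)
    then obtain f :: "'a \<Rightarrow> real" where "linear f" "\<forall>w\<in>{x,y}. f w = (if w = x then 1 else 0)"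
      using linear_independent_extend[OF ind, of "\<lambda>w. if w = x then 1 else 0"] by auto
    with \<open>x \<noteq> y\<close> show ?thesis by auto
  qed
  then obtain f :: "'a \<Rightarrow> real" where f: "linear f" "f x = 1" "f y = 0" by blast
  have "f w \<le> norm w" if "w \<in> span {x, y}" for w
  proof -
    obtain a b where "w - a *\<^sub>R x = b *\<^sub>R y"
      using \<open>w \<in> span {x, y}\<close> unfolding span_breakdown_eq span_singleton by blast
    then have w: "w = a *\<^sub>R x + b *\<^sub>R y" by (simp add: diff_eq_eq add.commute)
    have fw: "f w = a" by (simp add: w linear_add[OF f(1)] linear_scale[OF f(1)] f)
    show ?thesis
    proof (cases "a = 0")
      case True then show ?thesis using fw by simp
    next
      case False
      have "a \<le> \<bar>a\<bar> * norm x" using \<open>norm x = 1\<close> by simp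
      also have "\<dots> \<le> \<bar>a\<bar> * norm (x + (b/a) *\<^sub>R y)"
        using orth unfolding birkhoff_james_orthogonal_def by (intro mult_left_mono) auto
      also have "\<dots> = norm (a *\<^sub>R (x + (b/a) *\<^sub>R y))" by simp
      also have "a *\<^sub>R (x + (b/a) *\<^sub>R y) = w" using False by (simp add: w scaleR_add_right)
      finally show ?thesis using fw by simp
    qed
  qed
  then obtain g where g: "linear g" "\<forall>w\<in>span {x, y}. g w = f w"
      "\<forall>w\<in>span (B \<union> span {x, y}). g w \<le> norm w"
    using dominated_functional_extend[OF f(1) subspace_span _ fin(1), of "{x, y}"] by metis
  have gx: "g x = 1" and gy: "g y = 0" using g(2) f by (auto simp: span_base)
  have "span (B \<union> span {x, y}) = UNIV"
    using fin(2) span_mono[of B "B \<union> span {x, y}"] by auto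
  then have le: "g w \<le> norm w" for w using g(3) by auto
  have abs: "norm (g w) \<le> norm w * 1" for w
    using le[of w] le[of "- w"] by (simp add: linear_neg[OF g(1)])
  have bl: "bounded_linear g"
    using g(1) abs by (intro bounded_linear.intro bounded_linear_axioms.intro exI[of _ 1]) auto
  define G where "G = Blinfun g"
  have G: "blinfun_apply G = g" using bl by (simp add: G_def bounded_linear_Blinfun_apply)
  have "norm G \<le> 1" using abs by (intro norm_blinfun_bound) (auto simp: G)
  moreover have "1 \<le> norm G" using norm_blinfun[of G x] gx \<open>norm x = 1\<close> by (simp add: G)
  ultimately show ?thesis using gx gy G by (intro exI[of _ G]) auto
qed

section \<open>Norm attainment and the kernel\<close>

text \<open>
  The functionals supplied for different \<open>y\<close> by the previous section all support the unit ball at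
  the same point, hence coincide. This is where a condition on each \<open>y\<close> separately becomes
  a linear one.
\<close>

lemma smooth_birkhoff_james_hyperplane:
  fixes z :: "'a::real_normed_vector"
  assumes fin: "finite B" "span B = (UNIV :: 'a set)" and smooth: "smooth_space TYPE('a)"
    and "z \<noteq> 0"
  shows "\<exists>f :: 'a \<Rightarrow>\<^sub>L real. blinfun_apply f z \<noteq> 0 \<and> (\<forall>y. z \<bottom>\<^sub>B y \<longrightarrow> blinfun_apply f y = 0)"
proof -
  define e where "e = (1 / norm z) *\<^sub>R z"
  have e: "norm e = 1" using \<open>z \<noteq> 0\<close> by (simp add: e_def)
  have z: "z = norm z *\<^sub>R e" using \<open>z \<noteq> 0\<close> by (simp add: e_def)
  obtain f :: "'a \<Rightarrow>\<^sub>L real" where f: "blinfun_apply f e = 1"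
    and uniq: "\<And>g. norm g = 1 \<Longrightarrow> blinfun_apply g e = 1 \<Longrightarrow> g = f"
    using smooth e unfolding smooth_space_def by metis
  \<comment> \<open>Smoothness speaks of unit vectors, so orthogonality is transferred from \<open>z\<close> to \<open>e\<close>.\<close>
  have "blinfun_apply f y = 0" if "z \<bottom>\<^sub>B y" for y
  proof -
    have "e \<bottom>\<^sub>B y"
      unfolding birkhoff_james_orthogonal_def
    proof
      fix c :: real
      have "norm z * norm e = norm z" using e by simp
      also have "\<dots> \<le> norm (z + (norm z * c) *\<^sub>R y)"
        using that unfolding birkhoff_james_orthogonal_def by blast
      also have "z + (norm z * c) *\<^sub>R y = norm z *\<^sub>R (e + c *\<^sub>R y)"
        using z by (metis scaleR_add_right scaleR_scaleR)
      also have "norm (norm z *\<^sub>R (e + c *\<^sub>R y)) = norm z * norm (e + c *\<^sub>R y)" by simp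
      finally show "norm e \<le> norm (e + c *\<^sub>R y)" using \<open>z \<noteq> 0\<close> by simp
    qed
    then obtain g :: "'a \<Rightarrow>\<^sub>L real"
      where "norm g = 1" "blinfun_apply g e = 1" "blinfun_apply g y = 0"
      using birkhoff_james_supporting_functional[OF fin e] by blast
    with uniq show ?thesis by metis
  qed
  moreover have "blinfun_apply f z \<noteq> 0"
    using f \<open>z \<noteq> 0\<close> by (subst z) (simp add: blinfun.scaleR_right)
  ultimately show ?thesis by blast
qed

text \<open>Adding a multiple of \<open>z\<close> to \<open>x\<close> does not change the image, whose norm is already as
  large as a unit vector permits.\<close>

lemma norm_attainment_orthogonal_kernel:
  assumes "T \<noteq> 0" and "x \<in> norm_attainment_set T" and "blinfun_apply T z = 0"
  shows "x \<bottom>\<^sub>B z"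
  unfolding birkhoff_james_orthogonal_def
proof
  fix c :: real
  have "norm T * norm x = norm (blinfun_apply T (x + c *\<^sub>R z))"
    using assms by (simp add: norm_attainment_set_def blinfun.add_right blinfun.scaleR_right)
  also have "\<dots> \<le> norm T * norm (x + c *\<^sub>R z)" by (rule norm_blinfun)
  finally show "norm x \<le> norm (x + c *\<^sub>R z)" using \<open>T \<noteq> 0\<close> by simp
qed

theorem span_norm_attainment_set_proper:
  fixes T :: "'a::real_normed_vector \<Rightarrow>\<^sub>L 'b::real_normed_vector"
  assumes "finite B" "span B = (UNIV :: 'a set)" and "smooth_space TYPE('a)"
    and "T \<noteq> 0" and "z \<noteq> 0" and "blinfun_apply T z = 0" and "right_symmetric z"
  shows "span (norm_attainment_set T) \<subset> UNIV"
proof -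
  obtain f :: "'a \<Rightarrow>\<^sub>L real" where fz: "blinfun_apply f z \<noteq> 0"
    and f: "\<And>y. z \<bottom>\<^sub>B y \<Longrightarrow> blinfun_apply f y = 0"
    using smooth_birkhoff_james_hyperplane assms(1-3,5) by blast
  have "blinfun_apply f x = 0" if "x \<in> norm_attainment_set T" for x
    using norm_attainment_orthogonal_kernel[OF assms(4) that assms(6)] assms(7) f
    unfolding right_symmetric_def by blast
  then have "blinfun_apply f x = 0" if "x \<in> span (norm_attainment_set T)" for x
    using linear_eq_0_on_span[OF bounded_linear.linear[OF blinfun.bounded_linear_right]] that
    by blast
  then show ?thesis using fz by blast
qed

section \<open>The coordinate argument for the p-norm\<close>

lemma lp_norm_nonneg: "0 \<le> lp_norm p x"
  by (simp add: lp_norm_def)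

lemma lp_norm_powr:
  assumes "0 < p"
  shows "lp_norm p x powr p = (\<Sum>k\<in>UNIV. \<bar>x $ k\<bar> powr p)"
  using assms by (simp add: lp_norm_def powr_powr sum_nonneg)

lemma component_le_lp_norm:
  assumes "0 < p"
  shows "\<bar>x $ k\<bar> \<le> lp_norm p x"
proof -
  have "\<bar>x $ k\<bar> powr p \<le> lp_norm p x powr p"
    unfolding lp_norm_powr[OF assms] by (rule member_le_sum) auto
  then show ?thesis
    using powr_less_mono2[OF assms lp_norm_nonneg, of p x "\<bar>x $ k\<bar>"] by linarith
qed

lemma lp_norm_pos:
  assumes "0 < p" and "x \<noteq> 0"
  shows "0 < lp_norm p x"
proof -
  obtain k where "x $ k \<noteq> 0" using assms(2) by (auto simp: vec_eq_iff)
  then show ?thesis using component_le_lp_norm[OF assms(1), of x k] by simp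
qed

lemma lp_norm_le_of_components:
  fixes x :: "real ^ 'n"
  assumes "0 < p" and "\<And>k. \<bar>x $ k\<bar> \<le> M"
  shows "lp_norm p x \<le> real CARD('n) powr (1/p) * M"
proof -
  have M: "0 \<le> M" using assms(2) abs_ge_zero order_trans by blast
  have "(\<Sum>k\<in>UNIV. \<bar>x $ k\<bar> powr p) \<le> (\<Sum>k\<in>(UNIV::'n set). M powr p)"
    using assms by (intro sum_mono powr_mono2) auto
  then have "lp_norm p x \<le> (real CARD('n) * M powr p) powr (1/p)"
    unfolding lp_norm_def using assms(1) by (intro powr_mono2) (auto simp: sum_nonneg)
  also have "\<dots> = real CARD('n) powr (1/p) * M"
    using assms(1) M by (simp add: powr_mult powr_powr)
  finally show ?thesis .
qed

text \<open>
  The supremum \<open>lp_onorm p S\<close> is only meaningful once the quotients are known to be bounded.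
  A crude bound suffices, obtained by comparing the \<open>p\<close>-norm on both sides with the Euclidean
  norm through the components.
\<close>

lemma lp_onorm_bound:
  fixes S :: "real ^ 'n \<Rightarrow> real ^ 'm"
  assumes p: "0 < p" and S: "linear S"
  shows "lp_norm p (S x) \<le> lp_onorm p S * lp_norm p x"
proof -
  obtain K where K: "0 < K" "\<And>x. norm (S x) \<le> norm x * K"
    using linear_conv_bounded_linear S bounded_linear.pos_bounded by blast
  define C where "C = real CARD('m) powr (1/p) * (real CARD('n) * K)"
  have "lp_norm p (S y) \<le> C * lp_norm p y" for y
  proof -
    have "norm y \<le> (\<Sum>k\<in>UNIV. \<bar>y $ k\<bar>)" by (rule norm_le_l1_cart)
    also have "\<dots> \<le> (\<Sum>k\<in>(UNIV::'n set). lp_norm p y)"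
      by (intro sum_mono component_le_lp_norm p)
    finally have y: "norm y \<le> real CARD('n) * lp_norm p y" by simp
    have "\<bar>S y $ k\<bar> \<le> real CARD('n) * lp_norm p y * K" for k
      using component_le_norm_cart[of "S y" k] K(2)[of y] mult_right_mono[OF y, of K] K(1) by linarith
    from lp_norm_le_of_components[OF p this] show ?thesis by (simp add: C_def mult_ac)
  qed
  then have "lp_norm p (S y) / lp_norm p y \<le> C" for y
    using lp_norm_pos[OF p, of y] K(1)
    by (cases "y = 0") (auto simp: divide_le_eq lp_norm_def C_def)
  then have "bdd_above (range (\<lambda>x. lp_norm p (S x) / lp_norm p x))"
    by (intro bdd_aboveI2)
  then have "lp_norm p (S x) / lp_norm p x \<le> lp_onorm p S"
    unfolding lp_onorm_def by (intro cSUP_upper) auto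
  then show ?thesis
    using lp_norm_pos[OF p, of x] linear_0[OF S]
    by (cases "x = 0") (auto simp: divide_le_eq lp_norm_def)
qed

lemma lp_onorm_pos:
  assumes p: "0 < p" and S: "linear S" and "S \<noteq> (\<lambda>_. 0)"
  shows "0 < lp_onorm p S"
proof -
  obtain y where "S y \<noteq> 0" using assms(3) by auto
  then have "0 < lp_onorm p S * lp_norm p y"
    using lp_norm_pos[OF p, of "S y"] lp_onorm_bound[OF p S, of y] by simp
  then show ?thesis using lp_norm_nonneg[of p y] by (simp add: zero_less_mult_iff)
qed

text \<open>The coordinate form of the orthogonality of norm-attaining vectors to the kernel: it is
  enough to compare \<open>x\<close> with the vector \<open>w\<close> obtained by deleting its \<open>i\<close>-th component.\<close>

lemma lp_norm_attained_imp_component_0: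
  fixes S :: "real ^ 'n \<Rightarrow> real ^ 'm"
  assumes p: "0 < p" and S: "linear S" and "S \<noteq> (\<lambda>_. 0)" and "S (axis i 1) = 0"
    and attained: "lp_onorm p S * lp_norm p x \<le> lp_norm p (S x)"
  shows "x $ i = 0"
proof -
  define w where "w = x - (x $ i) *\<^sub>R axis i 1"
  have "S w = S x" by (simp add: w_def linear_diff[OF S] linear_scale[OF S] assms(4))
  then have "lp_onorm p S * lp_norm p x \<le> lp_onorm p S * lp_norm p w"
    using attained lp_onorm_bound[OF p S, of w] by simp
  then have "lp_norm p x \<le> lp_norm p w" using lp_onorm_pos[OF p S assms(3)] by simp
  then have "lp_norm p x powr p \<le> lp_norm p w powr p"
    using p lp_norm_nonneg by (intro powr_mono2) auto
  then have "(\<Sum>k\<in>UNIV. \<bar>x $ k\<bar> powr p) \<le> (\<Sum>k\<in>UNIV. \<bar>w $ k\<bar> powr p)"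
    by (simp add: lp_norm_powr[OF p])
  moreover have "(\<Sum>k\<in>UNIV - {i}. \<bar>w $ k\<bar> powr p) = (\<Sum>k\<in>UNIV - {i}. \<bar>x $ k\<bar> powr p)"
    by (intro sum.cong) (auto simp: w_def axis_def)
  moreover have "w $ i = 0" by (simp add: w_def axis_def)
  ultimately have "\<bar>x $ i\<bar> powr p \<le> 0"
    using p by (simp add: sum.remove[of UNIV i])
  then show ?thesis by simp
qed

theorem lp_basis_min_less_onorm:
  fixes S :: "real ^ 'n \<Rightarrow> real ^ 'm" and x :: "'j::finite \<Rightarrow> real ^ 'n"
  assumes "0 < p" and "linear S" and "S \<noteq> (\<lambda>_. 0)" and "S (axis i 1) = 0"
    and "span (range x) = UNIV" and "\<And>j. lp_norm p (x j) = 1"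
  shows "Min (range (\<lambda>j. lp_norm p (S (x j)))) < lp_onorm p S"
proof (rule ccontr)
  assume "\<not> ?thesis"
  then have "lp_onorm p S \<le> lp_norm p (S (x j))" for j
    by (simp add: not_less)
  then have "x j $ i = 0" for j
    using lp_norm_attained_imp_component_0[OF assms(1-4), of "x j"] assms(6) by simp
  then have "range x \<subseteq> {y. y $ i = 0}" by auto
  moreover have "subspace {y :: real ^ 'n. y $ i = 0}" by (simp add: subspace_def)
  ultimately have "span (range x) \<subseteq> {y. y $ i = 0}" by (rule span_minimal)
  then have "axis i 1 \<in> {y :: real ^ 'n. y $ i = 0}" using assms(5) by blast
  then show False by (simp add: axis_def)
qed

theorem corollary2p2p3:
  fixes T :: "'a::banach \<Rightarrow>\<^sub>L 'a"
    and p :: real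
    and S :: "real ^ 'n \<Rightarrow> real ^ 'n"
    and i :: 'n
  shows "((\<exists>B::'a set. finite B \<and> span B = UNIV) \<and> smooth_space TYPE('a) \<and> T \<noteq> 0 \<and>
            (\<exists>z. z \<noteq> 0 \<and> blinfun_apply T z = 0 \<and> right_symmetric z)
          \<longrightarrow> span (norm_attainment_set T) \<subset> UNIV)
       \<and> (1 \<le> p \<and> linear S \<and> S \<noteq> (\<lambda>_. 0) \<and> S (axis i 1) = 0
          \<longrightarrow> (\<forall>x :: 'n \<Rightarrow> real ^ 'n.
                inj x \<and> independent (range x) \<and> span (range x) = UNIV \<and>
                (\<forall>j. lp_norm p (x j) = 1)
                \<longrightarrow> Min (range (\<lambda>j. lp_norm p (S (x j)))) < lp_onorm p S))"
proof (intro conjI impI allI; elim conjE exE)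
  fix B :: "'a set" and z
  assume "finite B" "span B = UNIV" "smooth_space TYPE('a)" "T \<noteq> 0"
    "z \<noteq> 0" "blinfun_apply T z = 0" "right_symmetric z"
  then show "span (norm_attainment_set T) \<subset> UNIV"
    by (rule span_norm_attainment_set_proper)
next
  fix x :: "'n \<Rightarrow> real ^ 'n"
  assume "1 \<le> p" "linear S" "S \<noteq> (\<lambda>_. 0)" "S (axis i 1) = 0"
    "span (range x) = UNIV" "\<forall>j. lp_norm p (x j) = 1"
  then show "Min (range (\<lambda>j. lp_norm p (S (x j)))) < lp_onorm p S"
    by (intro lp_basis_min_less_onorm) auto
qed

end
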